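(* Let $L\ge1$ be an integer and let $\kappa:\mathbb R\to\{1,\dots,L\}$ be a decreasing (non-increasing) function. Let $\mu_1,\dots,\mu_L:\mathbb R^N\to\mathbb R$ be monotone, convex, translation invariant and normalized functions such that $\mu_l\ge\mu_{l+1}$ for all $l\in\{1,\dots,L-1\}$. Let $\vec\tau:\mathbb R\to\mathbb R^N$ be component-wise non-decreasing. Define $\psi:\mathcal X\to\mathbb R$ by $$\psi(x)=\sup\{\upsilon\in\mathbb R:\ \mu_{\kappa(\upsilon)}(x-\vec\tau(\upsilon))\le0\},\qquad x\in\mathcal X.$$ Then $\psi\in\mathcal F_{\mathrm{QCo}}$, i.e. $\psi$ is monotone (non-decreasing) and quasiconcave.
   Context: Let $N\ge1$ and let $\mathcal X\subset\mathbb R^N$ be convex and compact; vector inequalities are component-wise and $\vec 1_N$ is the all-ones vector. $\mathfrak F$ is the set of bounded measurable functions $f:\mathcal X\to\mathbb R$, and $\mathcal F_{\mathrm{QCo}}\subset\mathfrak F$ is the set of those that are monotone non-decreasing ($x_1\le x_2$ implies $f(x_1)\le f(x_2)$) and quasiconcave ($f(\lambda x_1+(1-\lambda)x_2)\ge\min\{f(x_1),f(x_2)\}$ for all $x_1,x_2\in\mathcal X$, $\lambda\in[0,1]$). All valuation functions are taken in $\mathfrak F$; in particular $\psi$ is understood to be a well-defined element of $\mathfrak F$ (real-valued, bounded, measurable). For functions $\mu:\mathbb R^N\to\mathbb R$: monotone means $x\le y$ implies $\mu(x)\ge\mu(y)$; translation invariant means $\mu(x+\beta\vec 1_N)=\mu(x)-\beta$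 for all $x\in\mathbb R^N$ and $\beta\in\mathbb R$; normalized means $\mu(0)=0$. The inequality $\mu_l\ge\mu_{l+1}$ is pointwise. *)

theory Defs
  imports "HOL-Analysis.Analysis"
begin

text \<open>
  Functions on a set \<open>X\<close> are represented by total functions of which only the
  restriction to \<open>X\<close> matters. Measurability is Borel measurability on \<open>X\<close>.
  The order on \<open>real ^ 'n\<close> is the library's component-wise order.
\<close>

definition valuation_functions :: "(real ^ 'n) set \<Rightarrow> (real ^ 'n \<Rightarrow> real) set" where
  "valuation_functions X =
     {f. bounded (f ` X) \<and> f \<in> borel_measurable (restrict_space borel X)}"

definition quasiconcave_on :: "(real ^ 'n) set \<Rightarrow> (real ^ 'n \<Rightarrow> real) \<Rightarrow> bool" where
  "quasiconcave_on X f \<longleftrightarrow>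
     (\<forall>x1\<in>X. \<forall>x2\<in>X. \<forall>t\<in>{0..1}.
        f (t *\<^sub>R x1 + (1 - t) *\<^sub>R x2) \<ge> min (f x1) (f x2))"

definition F_QCo :: "(real ^ 'n) set \<Rightarrow> (real ^ 'n \<Rightarrow> real) set" where
  "F_QCo X = {f \<in> valuation_functions X. mono_on X f \<and> quasiconcave_on X f}"

definition translation_invariant :: "(real ^ 'n \<Rightarrow> real) \<Rightarrow> bool" where
  "translation_invariant \<mu> \<longleftrightarrow>
     (\<forall>x \<beta>. \<mu> (x + \<beta> *\<^sub>R (\<chi> i. 1)) = \<mu> x - \<beta>)"

definition normalized :: "(real ^ 'n \<Rightarrow> real) \<Rightarrow> bool" where
  "normalized \<mu> \<longleftrightarrow> \<mu> 0 = 0"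

definition acceptable_levels ::
  "(real \<Rightarrow> nat) \<Rightarrow> (nat \<Rightarrow> real ^ 'n \<Rightarrow> real) \<Rightarrow> (real \<Rightarrow> real ^ 'n) \<Rightarrow> real ^ 'n \<Rightarrow> real set" where
  "acceptable_levels \<kappa> \<mu> \<tau> x = {v. \<mu> (\<kappa> v) (x - \<tau> v) \<le> 0}"

text \<open>
  The supremum is taken in the reals, so the value is meaningful only where the set
  of acceptable levels is nonempty and bounded above.
\<close>

definition level_value ::
  "(real \<Rightarrow> nat) \<Rightarrow> (nat \<Rightarrow> real ^ 'n \<Rightarrow> real) \<Rightarrow> (real \<Rightarrow> real ^ 'n) \<Rightarrow> real ^ 'n \<Rightarrow> real" where
  "level_value \<kappa> \<mu> \<tau> x = Sup (acceptable_levels \<kappa> \<mu> \<tau> x)"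

end

theory Submission
  imports Defs
begin

text \<open>
  The value \<open>\<psi> x\<close> is the supremum of the set of acceptable levels of \<open>x\<close>, and two facts
  about these sets carry the proof.

  \<^item> They are down-closed in the level. Lowering \<open>v\<close> lowers \<open>\<tau> v\<close>, so the shifted position
    \<open>x - \<tau> v\<close> improves, and raises \<open>\<kappa> v\<close>, so the measure in use becomes more lenient; both
    changes decrease \<open>\<mu> (\<kappa> v) (x - \<tau> v)\<close> (\<open>acceptable_levels_downward\<close>). Hence every
    level strictly below \<open>\<psi> x\<close> is acceptable, although \<open>\<psi> x\<close> itself may not be
    (\<open>acceptable_below_level_value\<close>).

  \<^item> For a fixed level \<open>v\<close> both the index \<open>\<kappa> v\<close> and the target \<open>\<tau> v\<close> are fixed, so the
    positions that accept \<open>v\<close> form a sublevel set of a single antitone convex function: an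
    upward closed (\<open>acceptable_levels_mono\<close>) and convex (\<open>acceptable_levels_convex\<close>) set.

  Upward closure nests the sets of levels and gives monotonicity of \<open>\<psi>\<close>. For
  quasiconcavity, any \<open>v\<close> strictly below \<open>min (\<psi> x1) (\<psi> x2)\<close> is acceptable for both points,
  hence for each of their convex combinations, whose value is therefore at least \<open>v\<close>.
\<close>

lemma acceptable_levels_downward:
  assumes \<kappa>: "antimono \<kappa>" and \<tau>: "mono \<tau>"
    and \<mu>: "\<And>v. antimono (\<mu> (\<kappa> v))"
    and lenient: "\<And>v w x. v \<le> w \<Longrightarrow> \<mu> (\<kappa> v) x \<le> \<mu> (\<kappa> w) x"
    and w: "w \<in> acceptable_levels \<kappa> \<mu> \<tau> x" and "v \<le> w"
  shows "v \<in> acceptable_levels \<kappa> \<mu> \<tau> x"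
proof -
  have "x - \<tau> w \<le> x - \<tau> v"
    using monoD[OF \<tau> \<open>v \<le> w\<close>] by (rule diff_left_mono)
  then have "\<mu> (\<kappa> v) (x - \<tau> v) \<le> \<mu> (\<kappa> v) (x - \<tau> w)"
    by (rule antimonoD[OF \<mu>])
  also have "\<dots> \<le> \<mu> (\<kappa> w) (x - \<tau> w)"
    using \<open>v \<le> w\<close> by (rule lenient)
  finally show ?thesis
    using w by (simp add: acceptable_levels_def)
qed

lemma acceptable_levels_mono:
  assumes \<mu>: "\<And>v. antimono (\<mu> (\<kappa> v))" and "x \<le> y"
  shows "acceptable_levels \<kappa> \<mu> \<tau> x \<subseteq> acceptable_levels \<kappa> \<mu> \<tau> y"
proof -
  have "\<mu> (\<kappa> v) (y - \<tau> v) \<le> \<mu> (\<kappa> v) (x - \<tau> v)" for v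
    using \<open>x \<le> y\<close> by (intro antimonoD[OF \<mu>] diff_right_mono)
  then show ?thesis
    unfolding acceptable_levels_def by (blast intro: order_trans)
qed

lemma acceptable_levels_convex:
  assumes \<mu>: "convex_on UNIV (\<mu> (\<kappa> v))" and t: "t \<in> {0..1}"
    and x: "v \<in> acceptable_levels \<kappa> \<mu> \<tau> x" and y: "v \<in> acceptable_levels \<kappa> \<mu> \<tau> y"
  shows "v \<in> acceptable_levels \<kappa> \<mu> \<tau> (t *\<^sub>R x + (1 - t) *\<^sub>R y)"
proof -
  have "t *\<^sub>R x + (1 - t) *\<^sub>R y - \<tau> v = t *\<^sub>R (x - \<tau> v) + (1 - t) *\<^sub>R (y - \<tau> v)"
    by (simp add: algebra_simps)
  also have "\<mu> (\<kappa> v) \<dots> \<le> t * \<mu> (\<kappa> v) (x - \<tau> v) + (1 - t) * \<mu> (\<kappa> v) (y - \<tau> v)"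
    using \<mu> t by (auto simp: convex_on_def)
  also have "\<dots> \<le> 0"
    using x y t by (intro add_nonpos_nonpos mult_nonneg_nonpos) (auto simp: acceptable_levels_def)
  finally show ?thesis
    by (simp add: acceptable_levels_def)
qed

text \<open>
  The inequality \<open>v < level_value \<kappa> \<mu> \<tau> x\<close> must be strict: nothing makes the set of
  acceptable levels closed, so the supremum need not be attained.
\<close>

lemma acceptable_below_level_value:
  assumes down: "\<And>v w. w \<in> acceptable_levels \<kappa> \<mu> \<tau> x \<Longrightarrow> v \<le> w \<Longrightarrow> v \<in> acceptable_levels \<kappa> \<mu> \<tau> x"
    and "acceptable_levels \<kappa> \<mu> \<tau> x \<noteq> {}"
    and "v < level_value \<kappa> \<mu> \<tau> x"
  shows "v \<in> acceptable_levels \<kappa> \<mu> \<tau> x"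
proof -
  obtain w where "w \<in> acceptable_levels \<kappa> \<mu> \<tau> x" "v < w"
    using less_cSupD[OF assms(2)] assms(3) unfolding level_value_def by blast
  then show ?thesis
    using down by simp
qed

theorem theoremA4:
  fixes X :: "(real ^ 'n) set"
    and L :: nat
    and \<kappa> :: "real \<Rightarrow> nat"
    and \<mu> :: "nat \<Rightarrow> real ^ 'n \<Rightarrow> real"
    and \<tau> :: "real \<Rightarrow> real ^ 'n"
  assumes "convex X" and "compact X"
    and "L \<ge> 1"
    and "\<And>v. \<kappa> v \<in> {1..L}" and "antimono \<kappa>"
    and "\<And>l. l \<in> {1..L} \<Longrightarrow> antimono (\<mu> l)"
    and "\<And>l. l \<in> {1..L} \<Longrightarrow> convex_on UNIV (\<mu> l)"
    and "\<And>l. l \<in> {1..L} \<Longrightarrow> translation_invariant (\<mu> l)"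
    and "\<And>l. l \<in> {1..L} \<Longrightarrow> normalized (\<mu> l)"
    and "\<And>l x. l \<in> {1..<L} \<Longrightarrow> \<mu> l x \<ge> \<mu> (l + 1) x"
    and "mono \<tau>"
    and psi_real: "\<And>x. x \<in> X \<Longrightarrow>
        acceptable_levels \<kappa> \<mu> \<tau> x \<noteq> {} \<and> bdd_above (acceptable_levels \<kappa> \<mu> \<tau> x)"
    and psi_valuation: "level_value \<kappa> \<mu> \<tau> \<in> valuation_functions X"
  shows "level_value \<kappa> \<mu> \<tau> \<in> F_QCo X"
proof -
  have \<mu>_anti: "antimono (\<mu> (\<kappa> v))" and \<mu>_convex: "convex_on UNIV (\<mu> (\<kappa> v))" for v
    using assms(4,6,7) by blast+
  have decreasing: "\<mu> m x \<le> \<mu> l x" if "l \<le> m" "1 \<le> l" "m \<le> L" for l m x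
    using that
  proof (induction m rule: dec_induct)
    case base
    show ?case by simp
  next
    case (step m)
    have "\<mu> (Suc m) x \<le> \<mu> m x"
      using assms(10)[of m x] step.hyps step.prems by simp
    also have "\<dots> \<le> \<mu> l x"
      using step.IH step.prems by simp
    finally show ?case .
  qed
  have lenient: "\<mu> (\<kappa> v) x \<le> \<mu> (\<kappa> w) x" if "v \<le> w" for v w x
    using decreasing[OF antimonoD[OF \<open>antimono \<kappa>\<close> that]] assms(4)[of v] assms(4)[of w] by simp
  have below: "v \<in> acceptable_levels \<kappa> \<mu> \<tau> x" if "x \<in> X" "v < level_value \<kappa> \<mu> \<tau> x" for v x
    using acceptable_levels_downward[of \<kappa> \<tau> \<mu>, OF \<open>antimono \<kappa>\<close> \<open>mono \<tau>\<close> \<mu>_anti lenient]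
      psi_real[OF that(1)] that(2)
    by (blast intro: acceptable_below_level_value)
  have "mono_on X (level_value \<kappa> \<mu> \<tau>)"
  proof (rule mono_onI)
    fix x y assume "x \<in> X" "y \<in> X" "x \<le> y"
    then show "level_value \<kappa> \<mu> \<tau> x \<le> level_value \<kappa> \<mu> \<tau> y"
      unfolding level_value_def
      using psi_real acceptable_levels_mono[of \<mu> \<kappa>, OF \<mu>_anti]
      by (intro cSup_subset_mono) auto
  qed
  moreover have "quasiconcave_on X (level_value \<kappa> \<mu> \<tau>)"
    unfolding quasiconcave_on_def
  proof (intro ballI)
    fix x y and t :: real
    assume x: "x \<in> X" and y: "y \<in> X" and t: "t \<in> {0..1}"
    let ?z = "t *\<^sub>R x + (1 - t) *\<^sub>R y"
    have z: "?z \<in> X"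
      using convexD[OF \<open>convex X\<close> x y, of t "1 - t"] t by simp
    show "min (level_value \<kappa> \<mu> \<tau> x) (level_value \<kappa> \<mu> \<tau> y) \<le> level_value \<kappa> \<mu> \<tau> ?z"
    proof (rule dense_le)
      fix v assume "v < min (level_value \<kappa> \<mu> \<tau> x) (level_value \<kappa> \<mu> \<tau> y)"
      then have "v \<in> acceptable_levels \<kappa> \<mu> \<tau> ?z"
        using below[OF x] below[OF y] by (intro acceptable_levels_convex \<mu>_convex t) auto
      then show "v \<le> level_value \<kappa> \<mu> \<tau> ?z"
        unfolding level_value_def using psi_real[OF z] by (intro cSup_upper) auto
    qed
  qed
  ultimately show ?thesis
    using psi_valuation by (simp add: F_QCo_def)
qed

end
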